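(* Let $T \in \mathbb{R}^{m\times n}$ be a cell-to-face incidence matrix (each row has exactly two non-zero entries, one equal to $+1$ and one equal to $-1$), let $\Omega \in \mathbb{R}^{n\times n}$ be a diagonal matrix with strictly positive diagonal entries, and let $\Lambda \in \mathbb{R}^{m\times m}$ be a diagonal matrix with strictly positive diagonal entries. Put $$D = -\,T^{T} \Lambda\, T \in \mathbb{R}^{n\times n}.$$ Then for every $\alpha \in \mathbb{R}$, $$\rho(\Omega^{-1} D) \;=\; \rho\!\left( \Lambda^{\alpha}\, T\, \Omega^{-1} T^{T} \Lambda^{1-\alpha} \right) \;\le\; \max\left\{ \operatorname{diag}(\Lambda^{\alpha}) \circ \Big( \big|T\, \Omega^{-1} T^{T}\big| \operatorname{diag}(\Lambda^{1-\alpha}) \Big) \right\}.$$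
   Context: $n$ is the number of cells (control volumes) and $m$ the number of faces of a mesh; rows of $T$ are indexed by faces and columns by cells, the two non-zero entries of a row being located at the two cells adjacent to that face. $\Omega$ contains the cell volumes, $\Lambda$ the diffusive coefficients at the faces (face area times face diffusivity divided by the projected distance between adjacent cell centers), and $D$ is the discrete diffusive operator. Notation: $\rho(\cdot)$ is the spectral radius (maximum modulus of the complex eigenvalues). For a real matrix $A$, $|A|$ is the entry-wise absolute value, $[|A|]_{ij} = |[A]_{ij}|$. For a diagonal matrix $E$, $\operatorname{diag}(E)$ is the column vector of its diagonal entries. $\Lambda^{\beta}$ is the diagonal matrix with entries $[\Lambda]_{jj}^{\beta}$. $\circ$ is the entry-wise (Hadamard) product of vectors, and $\max\{v\}$ is the largest component of the vector $v$. *)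

theory Defs
  imports
    Complex_Main
    "Jordan_Normal_Form.Gauss_Jordan_Elimination"
    "Jordan_Normal_Form.Spectral_Radius"
begin

definition incidence_mat :: "real mat \<Rightarrow> bool" where
  "incidence_mat T \<longleftrightarrow>
     (\<forall>f < dim_row T. \<exists>c < dim_col T. \<exists>d < dim_col T.
        T $$ (f, c) = 1 \<and> T $$ (f, d) = - 1 \<and>
        (\<forall>k < dim_col T. k \<noteq> c \<and> k \<noteq> d \<longrightarrow> T $$ (f, k) = 0))"

(* Only meaningful for invertible A: the library's mat_inverse returns None otherwise. *)
abbreviation inv_mat :: "real mat \<Rightarrow> real mat" where
  "inv_mat A \<equiv> the (mat_inverse A)"

(* The library's spectral radius is that of a complex matrix. *)
definition real_spectral_radius :: "real mat \<Rightarrow> real" where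
  "real_spectral_radius A = spectral_radius (map_mat complex_of_real A)"

definition abs_mat :: "real mat \<Rightarrow> real mat" where
  "abs_mat A = map_mat abs A"

definition diag_vec :: "real mat \<Rightarrow> real vec" where
  "diag_vec E = vec_of_list (diag_mat E)"

(* Intended for diagonal matrices with positive diagonal; off-diagonal entries of E are ignored. *)
definition diag_powr :: "real mat \<Rightarrow> real \<Rightarrow> real mat" where
  "diag_powr E \<beta> = mat_diag (dim_row E) (\<lambda>j. E $$ (j, j) powr \<beta>)"

definition hadamard_vec :: "real vec \<Rightarrow> real vec \<Rightarrow> real vec" where
  "hadamard_vec u v = vec (dim_vec u) (\<lambda>i. u $ i * v $ i)"

(* Only meaningful for vectors of positive dimension. *)
definition max_vec :: "real vec \<Rightarrow> real" where
  "max_vec v = Max (vec_set v)"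

end

(*
  With P = diag_powr Lambda alpha, Q = diag_powr Lambda (1 - alpha) and W the inverse of Omega, set
  A = P T and B = W T^t Q.  Then A B is the face matrix, and B A = W T^t Lambda T is the negated
  cell matrix because the diagonal matrices satisfy Q P = Lambda.  The products A B and B A share
  their non-zero eigenvalues, and the spectral radius of A B is at most its largest absolute row sum.
*)
theory Submission
  imports Defs
begin

lemma spectral_radius_ge_0:
  assumes "A \<in> carrier_mat n n" and "n > 0"
  shows "0 \<le> spectral_radius A"
  using spectral_radius_mem_max(1)[OF assms] by auto

lemma norm_eigenvalue_le_spectral_radius:
  assumes "A \<in> carrier_mat n n" and "n > 0" and "eigenvalue A k"
  shows "norm k \<le> spectral_radius A"
  using spectral_radius_mem_max(2)[OF assms(1,2)] assms(3) by (auto simp: spectrum_def)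

text \<open>For \<open>n > 0\<close> the spectrum is finite and non-empty, so its maximal modulus is
  attained. Every comparison of spectral radii below starts from such an extremal
  eigenvector.\<close>

lemma spectral_radius_eigenvector:
  assumes A: "A \<in> carrier_mat n n" and n: "n > 0"
  obtains k v where "spectral_radius A = norm k" "v \<in> carrier_vec n" "v \<noteq> 0\<^sub>v n"
    "A *\<^sub>v v = k \<cdot>\<^sub>v v"
  using spectral_radius_mem_max(1)[OF A n] A
  by (auto simp: spectrum_def eigenvalue_def eigenvector_def)

text \<open>If \<open>v\<close> is an eigenvector of \<open>A * B\<close> for
  \<open>k \<noteq> 0\<close>, then \<open>B *\<^sub>v v\<close> is one of \<open>B * A\<close> for
  the same \<open>k\<close>. If the extremal eigenvalue is 0, nonnegativity of the right-hand side
  suffices. Swapping the roles of \<open>A\<close> and \<open>B\<close> later gives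
  equality.\<close>

lemma spectral_radius_mult_le:
  assumes A: "A \<in> carrier_mat m n" and B: "B \<in> carrier_mat n m" and m: "m > 0" and n: "n > 0"
  shows "spectral_radius (A * B) \<le> spectral_radius (B * A)"
proof -
  have AB: "A * B \<in> carrier_mat m m" and BA: "B * A \<in> carrier_mat n n"
    using A B by auto
  obtain k v where k: "spectral_radius (A * B) = norm k" and v: "v \<in> carrier_vec m" "v \<noteq> 0\<^sub>v m"
    and ev: "(A * B) *\<^sub>v v = k \<cdot>\<^sub>v v"
    using spectral_radius_eigenvector[OF AB m] .
  show ?thesis
  proof (cases "k = 0")
    case True
    then show ?thesis using k spectral_radius_ge_0[OF BA n] by simp
  next
    case False
    define w where "w = B *\<^sub>v v"
    have w: "w \<in> carrier_vec n" using B v by (simp add: w_def)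
    have Aw: "A *\<^sub>v w = k \<cdot>\<^sub>v v"
      using ev assoc_mult_mat_vec[OF A B v(1)] by (simp add: w_def)
    \<comment> \<open>This is where \<open>k \<noteq> 0\<close> enters: \<open>w = 0\<close> would
      force \<open>k\<close> times \<open>v\<close>, which equals \<open>A\<close> applied to
      \<open>w\<close>, to vanish, and hence \<open>v\<close> as well.\<close>
    have "w \<noteq> 0\<^sub>v n"
    proof
      assume "w = 0\<^sub>v n"
      then have kv: "k \<cdot>\<^sub>v v = 0\<^sub>v m"
        using Aw[symmetric] A by (intro eq_vecI) auto
      have "v = 0\<^sub>v m"
      proof (rule eq_vecI)
        fix i assume "i < dim_vec (0\<^sub>v m :: complex vec)"
        then have i: "i < m" by simp
        then have "(k \<cdot>\<^sub>v v) $ i = 0" using kv by simp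
        then show "v $ i = 0\<^sub>v m $ i" using False i v(1) by auto
      qed (use v in auto)
      with v(2) show False by simp
    qed
    moreover have "(B * A) *\<^sub>v w = k \<cdot>\<^sub>v w"
    proof -
      have "(B * A) *\<^sub>v w = B *\<^sub>v (k \<cdot>\<^sub>v v)"
        using assoc_mult_mat_vec[OF B A w] Aw by simp
      also have "\<dots> = k \<cdot>\<^sub>v w"
        unfolding w_def by (rule mult_mat_vec[OF B v(1)])
      finally show ?thesis .
    qed
    ultimately have "eigenvalue (B * A) k"
      using w B by (auto simp: eigenvalue_def eigenvector_def)
    then show ?thesis
      using norm_eigenvalue_le_spectral_radius[OF BA n] k by simp
  qed
qed

lemma spectral_radius_mult_commute:
  assumes "A \<in> carrier_mat m n" and "B \<in> carrier_mat n m" and "m > 0" and "n > 0"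
  shows "spectral_radius (A * B) = spectral_radius (B * A)"
  using spectral_radius_mult_le[of A m n B] spectral_radius_mult_le[of B n m A] assms
  by (intro antisym) auto

text \<open>Negation keeps eigenvectors and turns \<open>k\<close> into \<open>- k\<close>, of the
  same modulus. Applying the inequality to \<open>- A\<close> as well yields equality.\<close>

lemma spectral_radius_le_uminus:
  assumes A: "A \<in> carrier_mat n n" and n: "n > 0"
  shows "spectral_radius A \<le> spectral_radius (- A)"
proof -
  obtain k v where k: "spectral_radius A = norm k" and v: "v \<in> carrier_vec n" "v \<noteq> 0\<^sub>v n"
    and ev: "A *\<^sub>v v = k \<cdot>\<^sub>v v"
    using spectral_radius_eigenvector[OF A n] .
  have "(- A) *\<^sub>v v = - (k \<cdot>\<^sub>v v)"
    using A v ev by simp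
  also have "\<dots> = (- k) \<cdot>\<^sub>v v" by (rule eq_vecI) auto
  finally have "eigenvalue (- A) (- k)"
    using v A by (auto simp: eigenvalue_def eigenvector_def)
  from norm_eigenvalue_le_spectral_radius[OF _ n this] show ?thesis
    using A k by simp
qed

lemma spectral_radius_uminus:
  assumes "A \<in> carrier_mat n n" and "n > 0"
  shows "spectral_radius (- A) = spectral_radius A"
  using spectral_radius_le_uminus[OF assms] spectral_radius_le_uminus[of "- A" n] assms
  by simp

text \<open>The maximum norm bounds every eigenvalue: the eigenvector equation is read off in a row
  where the eigenvector has its component of largest modulus.\<close>

lemma spectral_radius_le_row_sum:
  assumes A: "A \<in> carrier_mat n n" and n: "n > 0"
    and bound: "\<And>i. i < n \<Longrightarrow> (\<Sum>j<n. norm (A $$ (i, j))) \<le> c"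
  shows "spectral_radius A \<le> c"
proof -
  obtain k v where k: "spectral_radius A = norm k" and v: "v \<in> carrier_vec n" "v \<noteq> 0\<^sub>v n"
    and ev: "A *\<^sub>v v = k \<cdot>\<^sub>v v"
    using spectral_radius_eigenvector[OF A n] .
  define N where "N = Max ((\<lambda>i. norm (v $ i)) ` {..<n})"
  have le_N: "norm (v $ j) \<le> N" if "j < n" for j
    unfolding N_def by (rule Max_ge) (use that in auto)
  have "N \<in> (\<lambda>i. norm (v $ i)) ` {..<n}"
    unfolding N_def by (rule Max_in) (use n in auto)
  then obtain i where i: "i < n" and N: "N = norm (v $ i)" by auto
  \<comment> \<open>Positivity allows the factor \<open>N\<close> to be cancelled from
    \<open>norm k * N \<le> c * N\<close> at the end.\<close>
  have "N > 0"
  proof (rule ccontr)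
    assume "\<not> N > 0"
    then have "norm (v $ j) \<le> 0" if "j < n" for j using le_N[OF that] by linarith
    then have "v = 0\<^sub>v n" using v(1) by (intro eq_vecI) auto
    with v(2) show False by simp
  qed
  have "k * v $ i = (\<Sum>j<n. A $$ (i, j) * v $ j)"
    using arg_cong[OF ev, of "\<lambda>u. u $ i"] i A v(1)
    by (simp add: scalar_prod_def atLeast0LessThan)
  then have "norm k * N = norm (\<Sum>j<n. A $$ (i, j) * v $ j)"
    by (metis N norm_mult)
  also have "\<dots> \<le> (\<Sum>j<n. norm (A $$ (i, j)) * N)"
    by (rule sum_norm_le) (simp add: norm_mult le_N mult_left_mono)
  also have "\<dots> = (\<Sum>j<n. norm (A $$ (i, j))) * N" by (simp add: sum_distrib_right)
  also have "\<dots> \<le> c * N" using bound[OF i] \<open>N > 0\<close> by (intro mult_right_mono) auto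
  finally show ?thesis using \<open>N > 0\<close> k by simp
qed

lemma real_spectral_radius_mult_commute:
  assumes "A \<in> carrier_mat m n" and "B \<in> carrier_mat n m" and "m > 0" and "n > 0"
  shows "real_spectral_radius (A * B) = real_spectral_radius (B * A)"
  unfolding real_spectral_radius_def
    of_real_hom.mat_hom_mult[OF assms(1,2)] of_real_hom.mat_hom_mult[OF assms(2,1)]
  by (rule spectral_radius_mult_commute[of _ m n]) (use assms in auto)

lemma real_spectral_radius_uminus:
  assumes "A \<in> carrier_mat n n" and "n > 0"
  shows "real_spectral_radius (- A) = real_spectral_radius A"
proof -
  have "map_mat complex_of_real (- A) = - map_mat complex_of_real A"
    by (rule eq_matI) auto
  then show ?thesis
    unfolding real_spectral_radius_def
    using spectral_radius_uminus[of "map_mat complex_of_real A" n] assms by simp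
qed

lemma real_spectral_radius_le_row_sum:
  assumes "A \<in> carrier_mat n n" and "n > 0"
    and "\<And>i. i < n \<Longrightarrow> (\<Sum>j<n. \<bar>A $$ (i, j)\<bar>) \<le> c"
  shows "real_spectral_radius A \<le> c"
  unfolding real_spectral_radius_def
  by (rule spectral_radius_le_row_sum[of _ n]) (use assms in auto)

text \<open>\<open>inv_mat\<close> is \<open>the\<close> of an option, so even its dimensions are
  known only once a non-zero determinant has excluded \<open>None\<close>.\<close>

lemma inv_mat_carrier:
  assumes A: "A \<in> carrier_mat n n" and det: "det A \<noteq> 0"
  shows "inv_mat A \<in> carrier_mat n n"
proof (cases "mat_inverse A")
  case None
  then show ?thesis
    using mat_inverse(1)[OF A, of "()"] det_non_zero_imp_unit[OF A det, of "()"] by simp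
next
  case (Some B)
  then show ?thesis using mat_inverse(2)[OF A Some] by simp
qed

lemma det_diagonal_mat:
  assumes "A \<in> carrier_mat n n" and "diagonal_mat A"
  shows "det A = prod_list (diag_mat A)"
  by (rule det_upper_triangular)
    (use assms in \<open>auto simp: diagonal_mat_def intro!: upper_triangularI\<close>)

text \<open>On the diagonal \<open>x powr \<alpha> * x powr \<beta> = x powr 1 = x\<close> for
  positive \<open>x\<close>; off the diagonal both sides are zero because \<open>E\<close> is
  diagonal.\<close>

lemma diag_powr_add:
  assumes E: "E \<in> carrier_mat m m" and "diagonal_mat E" and "\<forall>j<m. E $$ (j, j) > 0"
    and "\<alpha> + \<beta> = 1"
  shows "diag_powr E \<alpha> * diag_powr E \<beta> = E"
proof -
  have "dim_row E = m" using E by simp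
  then show ?thesis
    unfolding diag_powr_def mat_diag_diag
    using assms by (intro eq_matI) (auto simp: mat_diag_def diagonal_mat_def powr_add[symmetric])
qed

theorem mainTheorem2:
  fixes T \<Omega> \<Lambda> D :: "real mat" and m n :: nat and \<alpha> :: real
  assumes "m > 0"
    and "T \<in> carrier_mat m n" and "incidence_mat T"
    and "\<Omega> \<in> carrier_mat n n" and "diagonal_mat \<Omega>" and "\<forall>i<n. \<Omega> $$ (i, i) > 0"
    and "\<Lambda> \<in> carrier_mat m m" and "diagonal_mat \<Lambda>" and "\<forall>j<m. \<Lambda> $$ (j, j) > 0"
    and "D = - (transpose_mat T * \<Lambda> * T)"
  shows "real_spectral_radius (inv_mat \<Omega> * D) =
           real_spectral_radius
             (diag_powr \<Lambda> \<alpha> * T * inv_mat \<Omega> * transpose_mat T * diag_powr \<Lambda> (1 - \<alpha>))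
       \<and> real_spectral_radius
             (diag_powr \<Lambda> \<alpha> * T * inv_mat \<Omega> * transpose_mat T * diag_powr \<Lambda> (1 - \<alpha>))
         \<le> max_vec (hadamard_vec (diag_vec (diag_powr \<Lambda> \<alpha>))
               (abs_mat (T * inv_mat \<Omega> * transpose_mat T) *\<^sub>v diag_vec (diag_powr \<Lambda> (1 - \<alpha>))))"
proof -
  define P where "P = diag_powr \<Lambda> \<alpha>"
  define Q where "Q = diag_powr \<Lambda> (1 - \<alpha>)"
  define W where "W = inv_mat \<Omega>"
  note T = assms(2)
  have "det \<Omega> \<noteq> 0"
    using det_diagonal_mat[OF assms(4,5)] assms(4,6)
    by (auto simp: prod_list_zero_iff diag_mat_def)
  then have W: "W \<in> carrier_mat n n"
    unfolding W_def by (rule inv_mat_carrier[OF assms(4)])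
  have P: "P \<in> carrier_mat m m" and Q: "Q \<in> carrier_mat m m"
    using assms(7) by (auto simp: P_def Q_def diag_powr_def)
  have Tt: "transpose_mat T \<in> carrier_mat n m" using T by simp
  \<comment> \<open>There is at least one face, and its row has an entry 1 in some column, so there
    is at least one cell.\<close>
  have n: "n > 0"
    using assms(1,3) T by (fastforce simp: incidence_mat_def)
  have QP: "Q * P = \<Lambda>"
    unfolding P_def Q_def by (rule diag_powr_add[OF assms(7-9)]) simp
  define S where "S = T * W * transpose_mat T"
  have S: "S \<in> carrier_mat m m" using T W by (simp add: S_def)
  define A where "A = P * T"
  define B where "B = W * transpose_mat T * Q"
  have A: "A \<in> carrier_mat m n" and B: "B \<in> carrier_mat n m"
    using P T W Q by (auto simp: A_def B_def)
  \<comment> \<open>The face matrix is bracketed in two ways: as \<open>A * B\<close> for the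
    exchange of factors, and as \<open>P * S * Q\<close> for the row sums.\<close>
  have AB: "P * T * W * transpose_mat T * Q = A * B"
    unfolding A_def B_def
    using assoc_mult_mat[of "P * T" m n "W * transpose_mat T" m Q m]
      assoc_mult_mat[of "P * T" m n W n "transpose_mat T" m] P T W Tt Q by simp
  have PSQ: "P * T * W * transpose_mat T * Q = P * S * Q"
    unfolding S_def
    using assoc_mult_mat[of P m m "T * W" n "transpose_mat T" m] P T W Tt by simp
  \<comment> \<open>Reassociation brings the two diagonal powers together, so that they merge into
    \<open>\<Lambda>\<close> whatever \<open>\<alpha>\<close> is.\<close>
  have "B * A = W * (transpose_mat T * (Q * P) * T)"
    unfolding A_def B_def
    using assoc_mult_mat[of W n n "transpose_mat T * Q" m "P * T" n]
      assoc_mult_mat[of "transpose_mat T" n m Q m "P * T" n]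
      assoc_mult_mat[of "transpose_mat T" n m "Q * P" m T n] P T W Tt Q by simp
  then have "W * D = - (B * A)"
    using assms(7,10) T W by (simp add: QP)
  then have eq: "real_spectral_radius (W * D) = real_spectral_radius (A * B)"
    using real_spectral_radius_uminus[of "B * A" n] A B n assms(1)
      real_spectral_radius_mult_commute[OF A B] by simp
  define r where "r = hadamard_vec (diag_vec P) (abs_mat S *\<^sub>v diag_vec Q)"
  have dim_r: "dim_vec r = m"
    using P by (simp add: r_def hadamard_vec_def diag_vec_def diag_mat_def)
  \<comment> \<open>\<open>P\<close> scales the rows of \<open>S\<close> and \<open>Q\<close> its
    columns. Values of \<open>powr\<close> are nonnegative, so they leave the absolute value
    unchanged, and the row sum equals the component of \<open>r\<close> exactly.\<close>
  have row_sum: "(\<Sum>j<m. \<bar>(P * S * Q) $$ (i, j)\<bar>) = r $ i" if i: "i < m" for i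
  proof -
    have L: "dim_row \<Lambda> = m" using assms(7) by simp
    have PS: "P * S = mat m m (\<lambda>(i, j). \<Lambda> $$ (i, i) powr \<alpha> * S $$ (i, j))"
      unfolding P_def diag_powr_def L by (rule mat_diag_mult_left[OF S])
    have PSQ_entry: "(P * S * Q) $$ (i, j) =
        \<Lambda> $$ (i, i) powr \<alpha> * S $$ (i, j) * \<Lambda> $$ (j, j) powr (1 - \<alpha>)"
      if "j < m" for j
    proof -
      have "P * S * Q = mat m m (\<lambda>(i, j). (P * S) $$ (i, j) * \<Lambda> $$ (j, j) powr (1 - \<alpha>))"
        unfolding Q_def diag_powr_def L by (rule mat_diag_mult_right) (use P S in simp)
      then show ?thesis using i that by (simp add: PS)
    qed
    have P_diag: "diag_vec P = vec m (\<lambda>j. \<Lambda> $$ (j, j) powr \<alpha>)"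
      and Q_diag: "diag_vec Q = vec m (\<lambda>j. \<Lambda> $$ (j, j) powr (1 - \<alpha>))"
      using P Q by (auto simp: diag_vec_def diag_mat_def P_def Q_def diag_powr_def mat_diag_def L
          vec_of_list_index)
    have "r $ i = \<Lambda> $$ (i, i) powr \<alpha> *
        (\<Sum>j<m. \<bar>S $$ (i, j)\<bar> * \<Lambda> $$ (j, j) powr (1 - \<alpha>))"
      using i S by (simp add: r_def hadamard_vec_def P_diag Q_diag abs_mat_def scalar_prod_def
          atLeast0LessThan)
    then show ?thesis
      by (simp add: PSQ_entry abs_mult sum_distrib_left mult.assoc)
  qed
  have "real_spectral_radius (P * S * Q) \<le> max_vec r"
  proof (rule real_spectral_radius_le_row_sum[OF _ assms(1)])
    show "P * S * Q \<in> carrier_mat m m" using P S Q by simp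
    fix i assume i: "i < m"
    have "r $ i \<le> max_vec r"
      unfolding max_vec_def vec_set_def by (rule Max_ge) (use i dim_r in auto)
    then show "(\<Sum>j<m. \<bar>(P * S * Q) $$ (i, j)\<bar>) \<le> max_vec r"
      using row_sum[OF i] by simp
  qed
  then show ?thesis
    using eq AB PSQ by (simp add: P_def Q_def W_def S_def r_def)
qed

end
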